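(* Let $P$ be a $d$-polytope and $G(P)$ a polytopal digraph of $P$. Suppose that there is a topological sort $v_1,\dots,v_n$ of $G(P)$ such that $F(v_1),\dots,F(v_n)$ is a shelling of $P^*$. Then for any topological sort $w_1,\dots,w_n$ of $G(P)$, $F(w_1),\dots,F(w_n)$ is a shelling of $P^*$.
   Context: A polytopal digraph $G(P)$ is an orientation of the edges of the skeleton of the polytope $P$. A topological sort of $G(P)$ is an ordering of the vertices such that $u$ precedes $w$ whenever $(u,w)$ is a directed edge. $P^*$ is a combinatorial polar of $P$ (a polytope whose face lattice is that of $P$ turned upside down), and for a vertex $v$ of $P$, $F(v)$ denotes the corresponding facet of $P^*$. A shelling of a polytope $Q$ is a linear ordering $F_1,\dots,F_s$ of its facets such that either the facets are points, or (i) $F_1$ has a linear ordering of its own facets that is a shelling of $F_1$, and (ii) for $1<j\le s$, $F_j\cap\bigcup_{i<j}F_i$ is non-empty and equals $G_1\cup\cdots\cup G_r$ for some shelling $G_1,\dots,G_r,\dots,G_t$ of $F_j$ with $1\le r\le t$. *)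

theory Defs
  imports "HOL-Analysis.Analysis"
begin

definition skeleton_adj :: "'a::euclidean_space set \<Rightarrow> 'a \<Rightarrow> 'a \<Rightarrow> bool" where
  "skeleton_adj P u w \<longleftrightarrow>
     u extreme_point_of P \<and> w extreme_point_of P \<and> closed_segment u w edge_of P"

text \<open>
  The orientation of each edge is arbitrary: it need not come from a linear functional, and
  acyclicity is not assumed.
\<close>

definition polytopal_digraph :: "'a::euclidean_space set \<Rightarrow> ('a \<times> 'a) set \<Rightarrow> bool" where
  "polytopal_digraph P E \<longleftrightarrow>
     (\<forall>(u, w)\<in>E. skeleton_adj P u w) \<and>
     (\<forall>u w. skeleton_adj P u w \<longrightarrow>
        ((u, w) \<in> E \<and> (w, u) \<notin> E) \<or> ((w, u) \<in> E \<and> (u, w) \<notin> E))"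

definition topological_sort ::
  "'a::euclidean_space set \<Rightarrow> ('a \<times> 'a) set \<Rightarrow> 'a list \<Rightarrow> bool" where
  "topological_sort P E vs \<longleftrightarrow>
     distinct vs \<and> set vs = {v. v extreme_point_of P} \<and>
     (\<forall>i<length vs. \<forall>j<length vs. (vs ! i, vs ! j) \<in> E \<longrightarrow> i < j)"

text \<open>
  The face lattice contains the improper faces \<open>{}\<close> and \<open>P\<close>. The anti-isomorphism \<open>\<phi>\<close> is part
  of the data; the facet of \<open>Q\<close> corresponding to a vertex \<open>v\<close> of \<open>P\<close> is \<open>\<phi> {v}\<close>.
\<close>

definition combinatorial_polar ::
  "'a::euclidean_space set \<Rightarrow> 'b::euclidean_space set \<Rightarrow> ('a set \<Rightarrow> 'b set) \<Rightarrow> bool" where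
  "combinatorial_polar P Q \<phi> \<longleftrightarrow>
     polytope Q \<and>
     bij_betw \<phi> {A. A face_of P} {B. B face_of Q} \<and>
     (\<forall>A B. A face_of P \<longrightarrow> B face_of P \<longrightarrow> (A \<subseteq> B \<longleftrightarrow> \<phi> B \<subseteq> \<phi> A))"

definition facet_ordering :: "'a::euclidean_space set \<Rightarrow> 'a set list \<Rightarrow> bool" where
  "facet_ordering Q Fs \<longleftrightarrow> distinct Fs \<and> set Fs = {F. F facet_of Q}"

text \<open>
  List indices start at 0, so \<open>Fs ! 0\<close> is the first facet and \<open>take r Gs\<close> is
  \<open>G\<^sub>1, \<dots>, G\<^sub>r\<close>. Since \<open>facet_of\<close> excludes the empty face, a single point has no facets.
\<close>

inductive polytope_shelling :: "'a::euclidean_space set \<Rightarrow> 'a set list \<Rightarrow> bool" where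
  points:
    "\<lbrakk>facet_ordering Q Fs; \<forall>F\<in>set Fs. \<exists>x. F = {x}\<rbrakk> \<Longrightarrow> polytope_shelling Q Fs"
| step:
    "\<lbrakk>facet_ordering Q Fs; Fs \<noteq> [];
      \<exists>Gs. polytope_shelling (Fs ! 0) Gs;
      \<forall>j. 0 < j \<and> j < length Fs \<longrightarrow>
        Fs ! j \<inter> (\<Union>i<j. Fs ! i) \<noteq> {} \<and>
        (\<exists>Gs r. polytope_shelling (Fs ! j) Gs \<and> 1 \<le> r \<and> r \<le> length Gs \<and>
           Fs ! j \<inter> (\<Union>i<j. Fs ! i) = \<Union>(set (take r Gs)))\<rbrakk>
     \<Longrightarrow> polytope_shelling Q Fs"

end

theory Submission
  imports Defs
begin

text \<open>
  Along a shelling that is a topological sort, the facets of \<open>F(v)\<close> are the sets dual to the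
  edges of \<open>P\<close> at \<open>v\<close>, so \<open>F(v)\<close> meets the union of its predecessors exactly in
  \<open>F(v) \<inter> \<Union>{F(u) | (u, v) \<in> E}\<close>, a set that does not mention the ordering. This forces, for
  every non-empty face \<open>K\<close> of the polar, the vertices \<open>v\<close> with \<open>K \<subseteq> F(v)\<close> to have a unique
  source, and unique sources imply the same description of the intersections along every other
  topological sort.
\<close>

section \<open>Faces of convex sets and polytopes\<close>

text \<open>A relative interior point of \<open>K\<close> lies in some member of
  \<open>\<T>\<close>, and a face of \<open>Q\<close> that meets the relative interior of a subset
  of \<open>Q\<close> contains that subset. This turns a cover by facets of the polar into
  containment in a single one.\<close>

lemma convex_subset_Union_faces:
  fixes K :: "'a::euclidean_space set"
  assumes "convex K" "K \<noteq> {}" "K \<subseteq> Q" "\<And>T. T \<in> \<T> \<Longrightarrow> T face_of Q" "K \<subseteq> \<Union>\<T>"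
  shows "\<exists>T\<in>\<T>. K \<subseteq> T"
proof -
  obtain x where x: "x \<in> rel_interior K"
    using assms rel_interior_eq_empty by blast
  then obtain T where T: "T \<in> \<T>" "x \<in> T"
    using assms(5) rel_interior_subset by blast
  then have "K \<subseteq> T"
    using subset_of_face_of[OF assms(4)[OF T(1)] assms(3)] x by blast
  with T show ?thesis by blast
qed

text \<open>The hypothesis \<open>min\<close> makes \<open>A\<close> a cover of \<open>{v}\<close>
  in the face lattice. A facet of \<open>A\<close> through \<open>v\<close> must then be
  \<open>{v}\<close> itself, so \<open>A\<close> has dimension 1 and is a segment, whose only
  extreme points are its two ends.\<close>

lemma segment_of_minimal_face:
  fixes P :: "'a::euclidean_space set"
  assumes P: "polytope P" and A: "A face_of P"
    and uv: "u extreme_point_of P" "v extreme_point_of P" "u \<in> A" "v \<in> A" "u \<noteq> v"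
    and min: "\<And>B. B face_of P \<Longrightarrow> v \<in> B \<Longrightarrow> B \<subseteq> A \<Longrightarrow> B = {v} \<or> B = A"
  shows "skeleton_adj P u v"
proof -
  have polA: "polytope A" using A P face_of_polytope_polytope by blast
  have exA: "u extreme_point_of A" "v extreme_point_of A"
    using uv extreme_point_of_face[OF A] by auto
  have vA: "{v} face_of A" using exA by (simp add: face_of_singleton)
  have neq: "{v} \<noteq> A" using uv by blast
  obtain F where F: "F facet_of A" "{v} \<subseteq> F"
    using face_of_polyhedron_subset_facet[OF polytope_imp_polyhedron[OF polA] vA _ neq] by blast
  have FA: "F face_of A" and dimF: "aff_dim F = aff_dim A - 1"
    using F unfolding facet_of_def by auto
  have "F face_of P" using FA A face_of_trans by blast
  moreover have "F \<noteq> A" using dimF by auto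
  ultimately have "F = {v}"
    using min F face_of_imp_subset[OF FA] by blast
  then have dimA: "aff_dim A = 1" using dimF by simp
  then have "collinear A" by (simp add: collinear_aff_dim)
  then obtain a b where ab: "A = closed_segment a b"
    using compact_convex_collinear_segment[of A] polA uv
      polytope_imp_compact polytope_imp_convex by blast
  have "u \<in> {a, b}" "v \<in> {a, b}"
    using exA unfolding ab by (auto simp: extreme_point_of_segment)
  with \<open>u \<noteq> v\<close> have "A = closed_segment u v"
    unfolding ab by (auto simp: closed_segment_commute)
  then show ?thesis
    using uv A dimA unfolding skeleton_adj_def edge_of_def by auto
qed

text \<open>Passing to a proper face lowers the dimension, and no integer lies strictly between
  \<open>aff_dim F - 1\<close> and \<open>aff_dim F\<close>.\<close>

lemma facet_maximal_face:
  fixes F :: "'a::euclidean_space set"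
  assumes "convex F" "G facet_of F" "B face_of F" "G \<subseteq> B"
  shows "B = G \<or> B = F"
proof (rule ccontr)
  assume neg: "\<not> (B = G \<or> B = F)"
  have G: "G face_of F" "aff_dim G = aff_dim F - 1"
    using assms(2) by (auto simp: facet_of_def)
  have cB: "convex B" using assms face_of_imp_convex by blast
  have "G face_of B"
    using face_of_subset[OF G(1) assms(4) face_of_imp_subset[OF assms(3)]] .
  then have "aff_dim G < aff_dim B"
    using face_of_aff_dim_lt[OF cB] neg by blast
  moreover have "aff_dim B < aff_dim F"
    using face_of_aff_dim_lt[OF assms(1,3)] neg by blast
  ultimately show False using G by simp
qed

section \<open>Duality between edges and common facets\<close>

lemma polar_face:
  assumes "combinatorial_polar P Q \<phi>" "A face_of P"
  shows "\<phi> A face_of Q"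
  using assms bij_betwE unfolding combinatorial_polar_def by blast

lemma polar_subset_iff:
  assumes "combinatorial_polar P Q \<phi>" "A face_of P" "B face_of P"
  shows "\<phi> B \<subseteq> \<phi> A \<longleftrightarrow> A \<subseteq> B"
  using assms unfolding combinatorial_polar_def by blast

lemma polar_obtain:
  assumes "combinatorial_polar P Q \<phi>" "B face_of Q"
  obtains A where "A face_of P" "B = \<phi> A"
  using assms unfolding combinatorial_polar_def bij_betw_def by blast

text \<open>Here \<open>G\<close> is \<open>\<phi> A\<close> for a face \<open>A\<close> containing
  \<open>u\<close> and \<open>v\<close>. A face between \<open>{v}\<close> and \<open>A\<close> is
  sent to a face between \<open>G\<close> and \<open>\<phi> {v}\<close>, so \<open>A\<close> is
  minimal over \<open>{v}\<close> and is therefore the edge joining \<open>u\<close> and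
  \<open>v\<close>.\<close>

lemma adjacent_of_common_facet:
  fixes P :: "'a::euclidean_space set" and Q :: "'b::euclidean_space set"
  assumes P: "polytope P" and pol: "combinatorial_polar P Q \<phi>"
    and uv: "u extreme_point_of P" "v extreme_point_of P" "u \<noteq> v"
    and G: "G facet_of \<phi> {v}" "G \<subseteq> \<phi> {u}"
  shows "skeleton_adj P u v"
proof -
  have ufc: "{u} face_of P" and vfc: "{v} face_of P"
    using uv by (simp_all add: face_of_singleton)
  have Gv: "G face_of \<phi> {v}" using G by (simp add: facet_of_def)
  have vQ: "\<phi> {v} face_of Q" using polar_face[OF pol vfc] .
  have "G face_of Q" using face_of_trans[OF Gv vQ] .
  then obtain A where A: "A face_of P" "G = \<phi> A" using polar_obtain[OF pol] by blast
  have "u \<in> A" using polar_subset_iff[OF pol ufc A(1)] G(2) A(2) by simp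
  have "v \<in> A"
    using polar_subset_iff[OF pol vfc A(1)] face_of_imp_subset[OF Gv] A(2) by simp
  have "B = {v} \<or> B = A" if B: "B face_of P" "v \<in> B" "B \<subseteq> A" for B
  proof -
    have sub: "\<phi> B \<subseteq> \<phi> {v}" using polar_subset_iff[OF pol vfc B(1)] B(2) by simp
    have "\<phi> B face_of \<phi> {v}"
      using face_of_subset[OF polar_face[OF pol B(1)] sub face_of_imp_subset[OF vQ]] .
    moreover have "G \<subseteq> \<phi> B" using polar_subset_iff[OF pol B(1) A(1)] B(3) A(2) by simp
    ultimately have "\<phi> B = G \<or> \<phi> B = \<phi> {v}"
      using facet_maximal_face[OF face_of_imp_convex[OF vQ] G(1)] by blast
    \<comment> \<open>The order equivalence, used in both directions, gives back equality of faces
      from equality of their images.\<close>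
    then show ?thesis
      using polar_subset_iff[OF pol B(1) A(1)] polar_subset_iff[OF pol A(1) B(1)]
        polar_subset_iff[OF pol B(1) vfc] polar_subset_iff[OF pol vfc B(1)] A(2) by blast
  qed
  then show ?thesis
    using segment_of_minimal_face[OF P A(1) uv(1,2) \<open>u \<in> A\<close> \<open>v \<in> A\<close> uv(3)] by blast
qed

section \<open>Intersections with earlier facets\<close>

text \<open>The family \<open>\<G>\<close> stands for the initial part of a shelling of
  \<open>\<phi> {vs ! j}\<close>. Each of its members lies in one earlier facet, hence comes from an
  edge, and this edge points into \<open>vs ! j\<close> because its other end is sorted earlier.
  Conversely, all in-neighbours of \<open>vs ! j\<close> precede it.\<close>

lemma shelling_intersection:
  fixes P :: "'a::euclidean_space set" and Q :: "'b::euclidean_space set"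
  assumes P: "polytope P" and E: "polytopal_digraph P E" and pol: "combinatorial_polar P Q \<phi>"
    and ts: "topological_sort P E vs" and j: "j < length vs"
    and Gs: "\<And>G. G \<in> \<G> \<Longrightarrow> G facet_of \<phi> {vs ! j}"
    and eq: "\<phi> {vs ! j} \<inter> (\<Union>i<j. \<phi> {vs ! i}) = \<Union>\<G>"
  shows "\<phi> {vs ! j} \<inter> (\<Union>i<j. \<phi> {vs ! i}) = \<phi> {vs ! j} \<inter> (\<Union>u\<in>{u. (u, vs ! j) \<in> E}. \<phi> {u})"
proof
  have dist: "distinct vs" and setvs: "set vs = {v. v extreme_point_of P}"
    and ord: "\<And>i j. i < length vs \<Longrightarrow> j < length vs \<Longrightarrow> (vs ! i, vs ! j) \<in> E \<Longrightarrow> i < j"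
    using ts unfolding topological_sort_def by auto
  have ext: "vs ! i extreme_point_of P" if "i < length vs" for i
    using that setvs nth_mem by blast
  then have fc: "\<phi> {vs ! i} face_of Q" if "i < length vs" for i
    using that polar_face[OF pol] by (simp add: face_of_singleton)
  show "\<phi> {vs ! j} \<inter> (\<Union>i<j. \<phi> {vs ! i}) \<subseteq> \<phi> {vs ! j} \<inter> (\<Union>u\<in>{u. (u, vs ! j) \<in> E}. \<phi> {u})"
  proof -
    have "\<exists>u. (u, vs ! j) \<in> E \<and> G \<subseteq> \<phi> {u}" if G: "G \<in> \<G>" for G
    proof -
      have Gf: "G face_of \<phi> {vs ! j}" "G \<noteq> {}" using Gs[OF G] by (auto simp: facet_of_def)
      have GQ: "G face_of Q" using face_of_trans[OF Gf(1) fc[OF j]] .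
      have "G \<subseteq> \<Union>((\<lambda>i. \<phi> {vs ! i}) ` {..<j})" using eq G by blast
      moreover have "T face_of Q" if "T \<in> (\<lambda>i. \<phi> {vs ! i}) ` {..<j}" for T
        using that fc j by auto
      ultimately obtain i where i: "i < j" "G \<subseteq> \<phi> {vs ! i}"
        using convex_subset_Union_faces[OF face_of_imp_convex[OF GQ] Gf(2) face_of_imp_subset[OF GQ]]
        by blast
      have il: "i < length vs" using i j by simp
      have "vs ! i \<noteq> vs ! j" using dist i j il by (simp add: nth_eq_iff_index_eq)
      then have "skeleton_adj P (vs ! i) (vs ! j)"
        using adjacent_of_common_facet[OF P pol ext[OF il] ext[OF j] _ Gs[OF G] i(2)] by blast
      then have "(vs ! i, vs ! j) \<in> E \<or> (vs ! j, vs ! i) \<in> E"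
        using E unfolding polytopal_digraph_def by blast
      then have "(vs ! i, vs ! j) \<in> E" using ord[OF j il] i(1) by auto
      with i show ?thesis by blast
    qed
    then show ?thesis unfolding eq using eq by blast
  qed
  show "\<phi> {vs ! j} \<inter> (\<Union>u\<in>{u. (u, vs ! j) \<in> E}. \<phi> {u}) \<subseteq> \<phi> {vs ! j} \<inter> (\<Union>i<j. \<phi> {vs ! i})"
  proof -
    have "\<exists>i<j. u = vs ! i" if "(u, vs ! j) \<in> E" for u
    proof -
      have "u extreme_point_of P"
        using E that unfolding polytopal_digraph_def skeleton_adj_def by auto
      then obtain i where "i < length vs" "u = vs ! i"
        using setvs by (metis in_set_conv_nth mem_Collect_eq)
      with ord[OF _ j] that show ?thesis by blast
    qed
    then show ?thesis by blast
  qed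
qed

text \<open>The order-free description passes from \<open>vs\<close> to \<open>ws\<close>. For
  \<open>j = 0\<close> the left side is empty, so the conclusion then says that
  \<open>F (ws ! 0)\<close> misses \<open>F u\<close> for every in-neighbour
  \<open>u\<close>.\<close>

lemma intersection_invariant:
  fixes F :: "'v \<Rightarrow> 'b::euclidean_space set"
  assumes fc: "\<And>v. v \<in> set vs \<Longrightarrow> F v face_of Q"
    and E: "\<And>u v. (u, v) \<in> E \<Longrightarrow> u \<in> set vs"
    and sets: "set ws = set vs"
    and ordv: "\<And>i j. i < length vs \<Longrightarrow> j < length vs \<Longrightarrow> (vs ! i, vs ! j) \<in> E \<Longrightarrow> i < j"
    and ordw: "\<And>i j. i < length ws \<Longrightarrow> j < length ws \<Longrightarrow> (ws ! i, ws ! j) \<in> E \<Longrightarrow> i < j"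
    and distw: "distinct ws"
    and eqv: "\<And>j. 0 < j \<Longrightarrow> j < length vs \<Longrightarrow>
        F (vs ! j) \<inter> (\<Union>i<j. F (vs ! i)) = F (vs ! j) \<inter> (\<Union>u\<in>{u. (u, vs ! j) \<in> E}. F u)"
    and j: "j < length ws"
  shows "F (ws ! j) \<inter> (\<Union>i<j. F (ws ! i)) = F (ws ! j) \<inter> (\<Union>u\<in>{u. (u, ws ! j) \<in> E}. F u)"
proof
  show "F (ws ! j) \<inter> (\<Union>u\<in>{u. (u, ws ! j) \<in> E}. F u) \<subseteq> F (ws ! j) \<inter> (\<Union>i<j. F (ws ! i))"
  proof -
    have "\<exists>i<j. u = ws ! i" if "(u, ws ! j) \<in> E" for u
      using E[OF that] that ordw[OF _ j] unfolding sets[symmetric] by (metis in_set_conv_nth)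
    then show ?thesis by blast
  qed
  show "F (ws ! j) \<inter> (\<Union>i<j. F (ws ! i)) \<subseteq> F (ws ! j) \<inter> (\<Union>u\<in>{u. (u, ws ! j) \<in> E}. F u)"
  proof
    fix x assume "x \<in> F (ws ! j) \<inter> (\<Union>i<j. F (ws ! i))"
    then obtain i where i: "i < j" "x \<in> F (ws ! j)" "x \<in> F (ws ! i)" by blast
    define K where "K = F (ws ! j) \<inter> F (ws ! i)"
    have il: "i < length ws" using i j by simp
    have memw: "ws ! k \<in> set vs" if "k < length ws" for k using that sets nth_mem by blast
    have KQ: "K face_of Q" unfolding K_def
      using face_of_Int[OF fc[OF memw[OF j]] fc[OF memw[OF il]]] .
    have "x \<in> K" using i K_def by simp
    \<comment> \<open>It suffices to find an in-neighbour of \<open>ws ! j\<close> in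
      \<open>S\<close>, since \<open>x\<close> lies in \<open>K\<close>.\<close>
    define S where "S = {v \<in> set vs. K \<subseteq> F v}"
    have inS: "ws ! j \<in> S" "ws ! i \<in> S" unfolding S_def K_def using memw j il by auto
    \<comment> \<open>Only the first element of \<open>S\<close> along \<open>vs\<close> can be a
      source of \<open>S\<close>: for any other, \<open>K\<close> is covered by the facets of its
      in-neighbours and so lies in one of them.\<close>
    have pred: "\<exists>u\<in>S. (u, vs ! k) \<in> E"
      if k: "k < length vs" "vs ! k \<in> S" "l < k" "vs ! l \<in> S" for k l
    proof -
      have "K \<subseteq> F (vs ! k) \<inter> (\<Union>i<k. F (vs ! i))" using k unfolding S_def by blast
      also have "\<dots> = F (vs ! k) \<inter> (\<Union>u\<in>{u. (u, vs ! k) \<in> E}. F u)" using eqv k by auto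
      finally have "K \<subseteq> \<Union>(F ` {u. (u, vs ! k) \<in> E})" by blast
      moreover have "T face_of Q" if "T \<in> F ` {u. (u, vs ! k) \<in> E}" for T
        using that fc E by blast
      ultimately obtain u where "(u, vs ! k) \<in> E" "K \<subseteq> F u"
        using convex_subset_Union_faces[OF face_of_imp_convex[OF KQ] _ face_of_imp_subset[OF KQ]]
          \<open>x \<in> K\<close> by blast
      then show ?thesis using E unfolding S_def by blast
    qed
    \<comment> \<open>The first element of \<open>S\<close> along \<open>ws\<close> is a source of
      \<open>S\<close>, because every in-neighbour would come earlier in \<open>ws\<close>.\<close>
    define m where "m = (LEAST k. k < length ws \<and> ws ! k \<in> S)"
    have m: "m < length ws" "ws ! m \<in> S"
      using LeastI[of "\<lambda>k. k < length ws \<and> ws ! k \<in> S" j] j inS unfolding m_def by auto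
    have mleast: "m \<le> k" if "k < length ws" "ws ! k \<in> S" for k
      unfolding m_def using that by (intro Least_le) simp
    have nopred: "(u, ws ! m) \<notin> E" if u: "u \<in> S" for u
    proof
      assume e: "(u, ws ! m) \<in> E"
      obtain k where k: "k < length ws" "u = ws ! k"
        using u sets unfolding S_def by (metis (no_types, lifting) in_set_conv_nth mem_Collect_eq)
      then show False using mleast[of k] u ordw[of k m] m e by fastforce
    qed
    have "m \<noteq> j" using mleast[OF il inS(2)] i by simp
    then have neq: "ws ! m \<noteq> ws ! j" using distw m j by (simp add: nth_eq_iff_index_eq)
    obtain a where a: "a < length vs" "ws ! m = vs ! a"
      using memw[OF m(1)] by (metis in_set_conv_nth)
    obtain b where b: "b < length vs" "ws ! j = vs ! b"
      using memw[OF j] by (metis in_set_conv_nth)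
    \<comment> \<open>The source \<open>ws ! m\<close> must also come first along \<open>vs\<close>,
      so \<open>ws ! j\<close> comes after it there and \<open>pred\<close> applies to
      \<open>ws ! j\<close>.\<close>
    have "\<not> b < a" using pred[of a b] nopred a b m inS by auto
    then have "a < b" using neq a b by (cases "a = b") auto
    then obtain u where "u \<in> S" "(u, ws ! j) \<in> E" using pred[of b a] a b m inS by auto
    then show "x \<in> F (ws ! j) \<inter> (\<Union>u\<in>{u. (u, ws ! j) \<in> E}. F u)"
      using i \<open>x \<in> K\<close> unfolding S_def by blast
  qed
qed

section \<open>Transfer of the shelling to another topological sort\<close>

theorem theorem3:
  fixes P :: "'a::euclidean_space set" and Pstar :: "'b::euclidean_space set"
    and \<phi> :: "'a set \<Rightarrow> 'b set" and E :: "('a \<times> 'a) set" and d :: nat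
  assumes "polytope P" and "aff_dim P = int d"
    and "polytopal_digraph P E"
    and "combinatorial_polar P Pstar \<phi>"
    and "\<exists>vs. topological_sort P E vs \<and> polytope_shelling Pstar (map (\<lambda>v. \<phi> {v}) vs)"
  shows "\<forall>ws. topological_sort P E ws \<longrightarrow> polytope_shelling Pstar (map (\<lambda>w. \<phi> {w}) ws)"
proof (intro allI impI)
  fix ws assume tw: "topological_sort P E ws"
  define F where "F = (\<lambda>v. \<phi> {v})"
  obtain vs where tv: "topological_sort P E vs" and sh: "polytope_shelling Pstar (map F vs)"
    using assms(5) unfolding F_def by blast
  have v: "distinct vs" "set vs = {v. v extreme_point_of P}"
    "\<And>i j. i < length vs \<Longrightarrow> j < length vs \<Longrightarrow> (vs ! i, vs ! j) \<in> E \<Longrightarrow> i < j"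
    using tv unfolding topological_sort_def by auto
  have w: "distinct ws" "set ws = {v. v extreme_point_of P}"
    "\<And>i j. i < length ws \<Longrightarrow> j < length ws \<Longrightarrow> (ws ! i, ws ! j) \<in> E \<Longrightarrow> i < j"
    using tw unfolding topological_sort_def by auto
  have sets: "set ws = set vs" using v w by simp
  have len: "length ws = length vs" using sets v(1) w(1) by (metis distinct_card)
  have Evs: "u \<in> set vs" if "(u, v) \<in> E" for u v
    using that assms(3) v(2) unfolding polytopal_digraph_def skeleton_adj_def by auto
  have fo: "facet_ordering Pstar (map F ws)" if "facet_ordering Pstar (map F vs)"
    using that sets v(1) w(1) by (auto simp: facet_ordering_def distinct_map)
  have "polytope_shelling Pstar (map F ws)"
    using sh
  proof cases
    case points
    \<comment> \<open>When all facets are points, any ordering of them is a shelling.\<close>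
    then show ?thesis using fo sets by (intro polytope_shelling.points) auto
  next
    case step
    have fc: "F v face_of Pstar" if "v \<in> set vs" for v
      using that v(2) polar_face[OF assms(4)] unfolding F_def by (simp add: face_of_singleton)
    have pos: "0 < length vs" using step(2) by simp
    have im: "(\<Union>i<j. map F xs ! i) = (\<Union>i<j. F (xs ! i))" if "j < length xs" for j xs
      using that by auto
    have st: "F (vs ! j) \<inter> (\<Union>i<j. F (vs ! i)) \<noteq> {}"
      "\<exists>Gs r. polytope_shelling (F (vs ! j)) Gs \<and> 1 \<le> r \<and> r \<le> length Gs \<and>
         F (vs ! j) \<inter> (\<Union>i<j. F (vs ! i)) = \<Union>(set (take r Gs))" if "0 < j" "j < length vs" for j
      using step(4) that im[OF that(2)] by auto
    have eqv: "F (vs ! j) \<inter> (\<Union>i<j. F (vs ! i)) = F (vs ! j) \<inter> (\<Union>u\<in>{u. (u, vs ! j) \<in> E}. F u)"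
      if j: "0 < j" "j < length vs" for j
    proof -
      obtain Gs r where Gs: "polytope_shelling (F (vs ! j)) Gs"
        "F (vs ! j) \<inter> (\<Union>i<j. F (vs ! i)) = \<Union>(set (take r Gs))"
        using st(2)[OF j] by blast
      have "facet_ordering (F (vs ! j)) Gs" using Gs(1) by cases auto
      then have "G facet_of F (vs ! j)" if "G \<in> set (take r Gs)" for G
        using that set_take_subset[of r Gs] unfolding facet_ordering_def by blast
      then show ?thesis
        using shelling_intersection[OF assms(1,3,4) tv j(2), of "set (take r Gs)"] Gs(2)
        unfolding F_def by blast
    qed
    have eqw: "F (ws ! j) \<inter> (\<Union>i<j. F (ws ! i)) = F (ws ! j) \<inter> (\<Union>u\<in>{u. (u, ws ! j) \<in> E}. F u)"
      if "j < length ws" for j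
      using intersection_invariant[of vs F Pstar E ws j] fc Evs sets v(3) w(1,3) eqv that by blast
    \<comment> \<open>All topological sorts start with the same vertex. Otherwise
      \<open>ws ! 0\<close> is some \<open>vs ! k\<close> with \<open>0 < k\<close>, whose facet
      meets those of its in-neighbours by the shelling condition, against \<open>eqw\<close> at
      index 0.\<close>
    have first: "ws ! 0 = vs ! 0"
    proof (rule ccontr)
      assume neq: "ws ! 0 \<noteq> vs ! 0"
      obtain k where k: "k < length vs" "ws ! 0 = vs ! k"
        using sets pos len by (metis in_set_conv_nth nth_mem)
      then have "0 < k" using neq by (cases k) auto
      then have "F (ws ! 0) \<inter> (\<Union>u\<in>{u. (u, ws ! 0) \<in> E}. F u) \<noteq> {}"
        using st(1) eqv k by auto
      then show False using eqw[of 0] pos len by auto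
    qed
    have main: "F (ws ! j) \<inter> (\<Union>i<j. F (ws ! i)) \<noteq> {} \<and>
      (\<exists>Gs r. polytope_shelling (F (ws ! j)) Gs \<and> 1 \<le> r \<and> r \<le> length Gs \<and>
         F (ws ! j) \<inter> (\<Union>i<j. F (ws ! i)) = \<Union>(set (take r Gs)))" if j: "0 < j" "j < length ws" for j
    proof -
      obtain k where k: "k < length vs" "ws ! j = vs ! k"
        using sets j by (metis in_set_conv_nth nth_mem)
      have "ws ! j \<noteq> ws ! 0" using nth_eq_iff_index_eq[OF w(1) j(2), of 0] j by linarith
      then have "0 < k" using first k by (cases k) auto
      \<comment> \<open>Both sides equal the same order-free set, so the shelling of
        \<open>F (vs ! k)\<close> and its initial part serve for \<open>F (ws ! j)\<close>
        unchanged.\<close>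
      then have "F (ws ! j) \<inter> (\<Union>i<j. F (ws ! i)) = F (vs ! k) \<inter> (\<Union>i<k. F (vs ! i))"
        using eqw[OF j(2)] eqv[of k] k by simp
      then show ?thesis using st[OF \<open>0 < k\<close> k(1)] k(2) by simp
    qed
    show ?thesis
    proof (rule polytope_shelling.step)
      show "facet_ordering Pstar (map F ws)" using fo step(1) by blast
      show "map F ws \<noteq> []" using pos len by auto
      show "\<exists>Gs. polytope_shelling (map F ws ! 0) Gs" using step(3) first pos len by auto
      show "\<forall>j. 0 < j \<and> j < length (map F ws) \<longrightarrow>
        map F ws ! j \<inter> (\<Union>i<j. map F ws ! i) \<noteq> {} \<and>
        (\<exists>Gs r. polytope_shelling (map F ws ! j) Gs \<and> 1 \<le> r \<and> r \<le> length Gs \<and>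
           map F ws ! j \<inter> (\<Union>i<j. map F ws ! i) = \<Union>(set (take r Gs)))"
        using main im[of _ ws] by simp
    qed
  qed
  then show "polytope_shelling Pstar (map (\<lambda>w. \<phi> {w}) ws)" unfolding F_def .
qed

end
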